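(* For any non-trivial connected graph $G$ and any integer $t\ge 3$, $$\dim_l(C_t\boxtimes G)\ge \left\lceil\frac{t}{D(G)}\right\rceil.$$
   Context: $C_t$ is the cycle on $t$ vertices and $D(G)$ is the diameter of $G$. A set $S$ is a local metric generator for a connected graph $X$ if for every two adjacent vertices $x,y$ there is $s\in S$ with $d_X(s,x)\ne d_X(s,y)$; $\dim_l(X)$ is the minimum cardinality of a local metric generator. The strong product $C_t\boxtimes G$ has vertex set $V(C_t)\times V(G)$, with $(a,b)\sim(c,d)$ iff ($a=c$ and $b\sim d$) or ($b=d$ and $a\sim c$) or ($a\sim c$ and $b\sim d$). *)

theory Defs
  imports "Graph_Theory.Graph_Theory"
begin

text \<open>
  Finite simple graphs are modelled by the locale \<^locale>\<open>pair_graph\<close> (finite vertex set, symmetric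
  irreflexive arc set), so that \<open>(u, v) \<in> parcs X\<close> is adjacency.
\<close>

definition graph_dist :: "'a pair_pre_digraph \<Rightarrow> 'a \<Rightarrow> 'a \<Rightarrow> nat" where
  "graph_dist X u v = (LEAST n. \<exists>p. pre_digraph.awalk (with_proj X) u p v \<and> length p = n)"

text \<open>
  Between connected vertices this is the shortest-path distance \<open>\<mu>\<close> of the library with unit arc
  costs. For disconnected vertices the value is meaningless.
\<close>

lemma (in pair_wf_digraph) graph_dist_eq_unit_cost_dist:
  assumes "u \<rightarrow>\<^sup>*\<^bsub>with_proj G\<^esub> v"
  shows "\<mu> (\<lambda>_. 1) u v = ereal (real (graph_dist G u v))"
proof -
  have cost: "awalk_cost (\<lambda>_. 1) p = real (length p)" for p
    by (induction p) auto
  let ?P = "\<lambda>n. \<exists>p. awalk u p v \<and> length p = n"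
  have dist: "graph_dist G u v = (LEAST n. ?P n)"
    by (simp add: graph_dist_def)
  have ex: "\<exists>n. ?P n"
    using assms by (auto simp: reachable_awalk)
  then obtain p where p: "awalk u p v" "length p = graph_dist G u v"
    unfolding dist using LeastI_ex[of ?P] by blast
  have least: "graph_dist G u v \<le> length q" if "awalk u q v" for q
    unfolding dist using that by (intro Least_le) auto
  show ?thesis
    unfolding \<mu>_def
  proof (rule antisym)
    show "(INF q\<in>{q. awalk u q v}. ereal (awalk_cost (\<lambda>_. 1) q)) \<le> ereal (real (graph_dist G u v))"
      using p by (intro INF_lower2[of p]) (auto simp: cost)
    show "ereal (real (graph_dist G u v)) \<le> (INF q\<in>{q. awalk u q v}. ereal (awalk_cost (\<lambda>_. 1) q))"
      by (intro INF_greatest) (auto simp: cost least)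
  qed
qed

text \<open>Meaningful for finite connected graphs only.\<close>

definition diameter :: "'a pair_pre_digraph \<Rightarrow> nat" where
  "diameter X = Max {graph_dist X u v | u v. u \<in> pverts X \<and> v \<in> pverts X}"

definition local_metric_generator :: "'a pair_pre_digraph \<Rightarrow> 'a set \<Rightarrow> bool" where
  "local_metric_generator X S \<longleftrightarrow>
     S \<subseteq> pverts X \<and> (\<forall>(x, y) \<in> parcs X. \<exists>s\<in>S. graph_dist X s x \<noteq> graph_dist X s y)"

definition local_metric_dim :: "'a pair_pre_digraph \<Rightarrow> nat" where
  "local_metric_dim X = (LEAST k. \<exists>S. local_metric_generator X S \<and> card S = k)"

definition cycle_graph :: "nat \<Rightarrow> nat pair_pre_digraph" where
  "cycle_graph t = \<lparr> pverts = {..<t},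
     parcs = {(i, j). i < t \<and> j < t \<and> (j = (i + 1) mod t \<or> i = (j + 1) mod t)} \<rparr>"

definition strong_product ::
    "'a pair_pre_digraph \<Rightarrow> 'b pair_pre_digraph \<Rightarrow> ('a \<times> 'b) pair_pre_digraph" where
  "strong_product G H = \<lparr> pverts = pverts G \<times> pverts H,
     parcs = {((a, b), (c, d)). (a, b) \<in> pverts G \<times> pverts H \<and> (c, d) \<in> pverts G \<times> pverts H \<and>
       (a = c \<and> (b, d) \<in> parcs H \<or> b = d \<and> (a, c) \<in> parcs G \<or>
        (a, c) \<in> parcs G \<and> (b, d) \<in> parcs H)} \<rparr>"

lemma pair_graph_cycle_graph:
  assumes "t \<ge> 3"
  shows "pair_graph (cycle_graph t)"
proof -
  have fin: "finite (parcs (cycle_graph t))"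
    by (rule finite_subset[of _ "{..<t} \<times> {..<t}"]) (auto simp: cycle_graph_def)
  show ?thesis
    using assms fin
    by unfold_locales
      (auto simp: cycle_graph_def symmetric_def sym_def arcs_ends_def arc_to_ends_def mod_Suc
        split: if_splits)
qed

lemma pair_graph_strong_product:
  assumes "pair_graph G" "pair_graph H"
  shows "pair_graph (strong_product G H)"
proof -
  interpret G: pair_graph G by fact
  interpret H: pair_graph H by fact
  have fin: "finite (parcs (strong_product G H))"
    by (rule finite_subset[of _ "(pverts G \<times> pverts H) \<times> (pverts G \<times> pverts H)"])
      (auto simp: strong_product_def)
  show ?thesis
    using fin
    by unfold_locales
      (auto simp: strong_product_def symmetric_def sym_def arcs_ends_def arc_to_ends_def
        dest: G.arcs_symmetric H.arcs_symmetric G.pair_no_loops H.pair_no_loops)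
qed

end

theory Submission
  imports Defs
begin

text \<open>
  Let \<open>D\<close> be the diameter of \<open>G\<close> and \<open>S\<close> a local metric generator. Distances in the strong product
  are maxima of the distances in the factors, so \<open>s = (j, w)\<close> can distinguish the ends of an edge
  inside the layer \<open>{i} \<times> G\<close> only if \<open>d(j, i) < D\<close>, and if \<open>d(j, i) \<ge> 1\<close> it does not distinguish
  \<open>(i, w)\<close> from \<open>(i, v)\<close> for a neighbour \<open>v\<close> of \<open>w\<close>. Hence each layer \<open>i\<close> either contains
  an element of \<open>S\<close> or has two elements of \<open>S\<close> in layers at distance less than \<open>D\<close>. Letting
  \<open>s\<close> contribute \<open>1\<close> to its own layer and \<open>1/2\<close> to the other layers at distance less than \<open>D\<close>,
  each layer receives at least \<open>1\<close>, while each \<open>s\<close> spends at most \<open>1 + (2D - 2)/2 = D\<close>.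
  So \<open>t \<le> D |S|\<close>.
\<close>

section \<open>Walks with pauses as relation powers\<close>

lemma relpow_Suc_left_iff: "(x, z) \<in> R ^^ Suc n \<longleftrightarrow> (\<exists>y. (x, y) \<in> R \<and> (y, z) \<in> R ^^ n)"
  by (meson relpow_Suc_D2 relpow_Suc_I2)

text \<open>Allowing a step to stand still trades "at most \<open>n\<close> steps" for "exactly
  \<open>n\<close> steps". Exact step counts are what can run in parallel in the two factors of a
  product.\<close>

lemma relpow_reflcl_iff: "(u, v) \<in> (R\<^sup>=) ^^ n \<longleftrightarrow> (\<exists>k\<le>n. (u, v) \<in> R ^^ k)"
proof (induction n arbitrary: v)
  case (Suc n)
  show ?case
  proof
    assume "(u, v) \<in> (R\<^sup>=) ^^ Suc n"
    then obtain w where w: "(u, w) \<in> (R\<^sup>=) ^^ n" "(w, v) \<in> R\<^sup>="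
      by (rule relpow_Suc_E)
    then obtain k where k: "k \<le> n" "(u, w) \<in> R ^^ k"
      using Suc by blast
    show "\<exists>k\<le>Suc n. (u, v) \<in> R ^^ k"
    proof (cases "w = v")
      case True
      with k show ?thesis by (auto intro!: exI[of _ k])
    next
      case False
      with w k have "(u, v) \<in> R ^^ Suc k" by (auto intro: relpow_Suc_I)
      with k show ?thesis by blast
    qed
  next
    assume "\<exists>k\<le>Suc n. (u, v) \<in> R ^^ k"
    then obtain k where k: "k \<le> Suc n" "(u, v) \<in> R ^^ k" by blast
    show "(u, v) \<in> (R\<^sup>=) ^^ Suc n"
    proof (cases "k \<le> n")
      case True
      with k Suc have "(u, v) \<in> (R\<^sup>=) ^^ n" by blast
      then show ?thesis by (rule relpow_Suc_I) simp
    next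
      case False
      with k have "(u, v) \<in> R ^^ Suc n" by (simp add: le_Suc_eq)
      then obtain w where "(u, w) \<in> R ^^ n" "(w, v) \<in> R" by (rule relpow_Suc_E)
      moreover from this have "(u, w) \<in> (R\<^sup>=) ^^ n" using Suc by blast
      ultimately show ?thesis by (auto intro: relpow_Suc_I)
    qed
  qed
qed auto

section \<open>Distance, diameter and dimension through relation powers\<close>

context pair_wf_digraph
begin

text \<open>The vertex condition on the right is for the empty walk: the zeroth relation power is
  the identity on the whole type, not only on the vertices.\<close>

lemma awalk_length_iff_relpow:
  "(\<exists>p. awalk u p v \<and> length p = n) \<longleftrightarrow> u \<in> pverts G \<and> (u, v) \<in> parcs G ^^ n"
proof (induction n arbitrary: u)
  case 0
  then show ?case by (auto simp: awalk_Nil_iff)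
next
  case (Suc n)
  have "(\<exists>p. awalk u p v \<and> length p = Suc n) \<longleftrightarrow>
      (\<exists>w. (u, w) \<in> parcs G \<and> (\<exists>p. awalk w p v \<and> length p = n))"
  proof
    assume "\<exists>p. awalk u p v \<and> length p = Suc n"
    then obtain e p where "awalk u (e # p) v" "length p = n" by (auto simp: length_Suc_conv)
    then show "\<exists>w. (u, w) \<in> parcs G \<and> (\<exists>p. awalk w p v \<and> length p = n)"
      by (intro exI[of _ "snd e"]) (auto simp: awalk_Cons_iff)
  next
    assume "\<exists>w. (u, w) \<in> parcs G \<and> (\<exists>p. awalk w p v \<and> length p = n)"
    then obtain w p where "(u, w) \<in> parcs G" "awalk w p v" "length p = n" by blast
    then show "\<exists>p. awalk u p v \<and> length p = Suc n"
      by (intro exI[of _ "(u, w) # p"]) (auto simp: awalk_Cons_iff)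
  qed
  also have "\<dots> \<longleftrightarrow> u \<in> pverts G \<and> (u, v) \<in> parcs G ^^ Suc n"
    unfolding Suc relpow_Suc_left_iff by (auto dest: in_arcsD1 in_arcsD2)
  finally show ?case .
qed

text \<open>Distances are handled only through their upper bounds, so no shortest walk has to be
  constructed later. Reachability ensures that the \<open>LEAST\<close> is attained.\<close>

lemma graph_dist_le_iff:
  assumes "u \<in> pverts G" "(u, v) \<in> (parcs G)\<^sup>*"
  shows "graph_dist G u v \<le> n \<longleftrightarrow> (u, v) \<in> ((parcs G)\<^sup>=) ^^ n"
proof -
  have dist: "graph_dist G u v = (LEAST n. (u, v) \<in> parcs G ^^ n)"
    unfolding graph_dist_def awalk_length_iff_relpow using assms by simp
  have "\<exists>n. (u, v) \<in> parcs G ^^ n"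
    using assms by (simp add: rtrancl_power)
  then have "(u, v) \<in> parcs G ^^ graph_dist G u v"
    unfolding dist by (rule LeastI_ex)
  moreover have "graph_dist G u v \<le> k" if "(u, v) \<in> parcs G ^^ k" for k
    unfolding dist using that by (rule Least_le)
  ultimately show ?thesis
    unfolding relpow_reflcl_iff by (meson le_trans)
qed

lemma graph_dist_refl: "u \<in> pverts G \<Longrightarrow> graph_dist G u u = 0"
  using graph_dist_le_iff[of u u 0] by simp

lemma graph_dist_eq_0D: "u \<in> pverts G \<Longrightarrow> (u, v) \<in> (parcs G)\<^sup>* \<Longrightarrow> graph_dist G u v = 0 \<Longrightarrow> u = v"
  using graph_dist_le_iff[of u v 0] by simp

end

lemma (in pair_fin_digraph) graph_dist_le_diameter:
  assumes "u \<in> pverts G" "v \<in> pverts G"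
  shows "graph_dist G u v \<le> diameter G"
  unfolding diameter_def
proof (rule Max_ge)
  have "{graph_dist G u v | u v. u \<in> pverts G \<and> v \<in> pverts G}
      = (\<lambda>(u, v). graph_dist G u v) ` (pverts G \<times> pverts G)"
    by auto
  then show "finite {graph_dist G u v | u v. u \<in> pverts G \<and> v \<in> pverts G}"
    using pair_finite_verts by simp
qed (use assms in blast)

lemma (in pair_graph) connected_imp_rtrancl_parcs:
  assumes "connected (with_proj G)" "u \<in> pverts G" "v \<in> pverts G"
  shows "(u, v) \<in> (parcs G)\<^sup>*"
proof -
  have "strongly_connected (with_proj G)"
    using assms(1) sym_arcs by (rule symmetric_connected_imp_strongly_connected[rotated])
  then have "u \<rightarrow>\<^sup>*\<^bsub>with_proj G\<^esub> v"
    using assms by (auto simp: strongly_connected_def)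
  then obtain p where "awalk u p v" by (auto simp: reachable_awalk)
  then show ?thesis
    using awalk_length_iff_relpow[of u v "length p"] by (auto simp: rtrancl_power)
qed

text \<open>The minimum is attained because the set of all vertices is a generator: an end
  \<open>x\<close> of an edge is at distance 0 from itself and at positive distance from the other
  end.\<close>

lemma (in pair_pseudo_graph) local_metric_generator_card_dim:
  assumes "\<And>x y. x \<in> pverts G \<Longrightarrow> y \<in> pverts G \<Longrightarrow> (x, y) \<in> (parcs G)\<^sup>*"
    and "\<And>x. (x, x) \<notin> parcs G"
  obtains S where "local_metric_generator G S" "card S = local_metric_dim G"
proof -
  have "\<exists>s\<in>pverts G. graph_dist G s x \<noteq> graph_dist G s y" if "(x, y) \<in> parcs G" for x y
  proof -
    have "x \<in> pverts G" "y \<in> pverts G" using that by (auto dest: in_arcsD1 in_arcsD2)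
    moreover have "x \<noteq> y" using that assms(2) by blast
    ultimately have "graph_dist G x x \<noteq> graph_dist G x y"
      using graph_dist_refl graph_dist_eq_0D assms(1) by metis
    with \<open>x \<in> pverts G\<close> show ?thesis by blast
  qed
  then have "local_metric_generator G (pverts G)"
    by (auto simp: local_metric_generator_def)
  then have "\<exists>k S. local_metric_generator G S \<and> card S = k" by blast
  from LeastI_ex[OF this] show ?thesis
    unfolding local_metric_dim_def[symmetric] using that by blast
qed

section \<open>Distances in strong products\<close>

lemma relpow_strong_product_iff:
  assumes "pair_wf_digraph G" "pair_wf_digraph H" "a \<in> pverts G" "b \<in> pverts H"
  shows "((a, b), (c, d)) \<in> ((parcs (strong_product G H))\<^sup>=) ^^ n \<longleftrightarrow>
    (a, c) \<in> ((parcs G)\<^sup>=) ^^ n \<and> (b, d) \<in> ((parcs H)\<^sup>=) ^^ n"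
  using assms(3,4)
proof (induction n arbitrary: a b)
  case (Suc n)
  interpret G: pair_wf_digraph G by fact
  interpret H: pair_wf_digraph H by fact
  \<comment> \<open>The three kinds of adjacency, together with standing still, are exactly the
    independent choices of "move or pause" in the two coordinates. Hence paused walks split
    coordinatewise.\<close>
  have step: "((a, b), (a', b')) \<in> (parcs (strong_product G H))\<^sup>= \<longleftrightarrow>
      (a, a') \<in> (parcs G)\<^sup>= \<and> (b, b') \<in> (parcs H)\<^sup>=" for a' b'
    using Suc.prems by (auto simp: strong_product_def dest: G.in_arcsD2 H.in_arcsD2)
  have verts: "a' \<in> pverts G" "b' \<in> pverts H"
    if "(a, a') \<in> (parcs G)\<^sup>=" "(b, b') \<in> (parcs H)\<^sup>=" for a' b'
    using that Suc.prems by (auto dest: G.in_arcsD2 H.in_arcsD2)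
  show ?case
    unfolding relpow_Suc_left_iff split_paired_Ex step using verts Suc.IH by blast
qed auto

context
  fixes G :: "'a pair_pre_digraph" and H :: "'b pair_pre_digraph" and a c :: 'a and b d :: 'b
  assumes GH: "pair_graph G" "pair_graph H"
    and ab: "a \<in> pverts G" "b \<in> pverts H"
    and reach: "(a, c) \<in> (parcs G)\<^sup>*" "(b, d) \<in> (parcs H)\<^sup>*"
begin

interpretation G: pair_graph G by (fact GH)
interpretation H: pair_graph H by (fact GH)
interpretation P: pair_graph "strong_product G H" by (intro pair_graph_strong_product GH)

lemma relpow_strong_product_iff_dist_le:
  "((a, b), (c, d)) \<in> ((parcs (strong_product G H))\<^sup>=) ^^ n \<longleftrightarrow>
    max (graph_dist G a c) (graph_dist H b d) \<le> n"
  using relpow_strong_product_iff[OF G.pair_wf_digraph H.pair_wf_digraph ab]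
    G.graph_dist_le_iff[OF ab(1) reach(1)] H.graph_dist_le_iff[OF ab(2) reach(2)]
  by simp

lemma rtrancl_strong_product: "((a, b), (c, d)) \<in> (parcs (strong_product G H))\<^sup>*"
  using relpow_strong_product_iff_dist_le rtrancl_power rtrancl_reflcl by (metis order_refl)

lemma graph_dist_strong_product:
  "graph_dist (strong_product G H) (a, b) (c, d) = max (graph_dist G a c) (graph_dist H b d)"
proof -
  have "(a, b) \<in> pverts (strong_product G H)" using ab by (simp add: strong_product_def)
  then have "graph_dist (strong_product G H) (a, b) (c, d) \<le> n \<longleftrightarrow>
      max (graph_dist G a c) (graph_dist H b d) \<le> n" for n
    using P.graph_dist_le_iff rtrancl_strong_product relpow_strong_product_iff_dist_le by blast
  then show ?thesis by (meson order_antisym order_refl)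
qed

end

section \<open>Balls in the cycle\<close>

lemma rtrancl_cycle_graph:
  assumes "i < t" "j < t" "t \<ge> 3"
  shows "(i, j) \<in> (parcs (cycle_graph t))\<^sup>*"
proof -
  interpret pair_graph "cycle_graph t" using assms(3) by (rule pair_graph_cycle_graph)
  have up: "(0, k) \<in> (parcs (cycle_graph t))\<^sup>*" if "k < t" for k
    using that
  proof (induction k)
    case (Suc k)
    then have "(k, Suc k) \<in> parcs (cycle_graph t)" by (simp add: cycle_graph_def)
    with Suc show ?case by (auto intro: rtrancl_into_rtrancl)
  qed simp
  have "sym (parcs (cycle_graph t))" by (auto intro: symI arcs_symmetric)
  with up[OF assms(1)] have "(i, 0) \<in> (parcs (cycle_graph t))\<^sup>*" by (meson symE sym_rtrancl)
  with up[OF assms(2)] show ?thesis by simp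
qed

text \<open>A walk is recorded by its net displacement \<open>k\<close>, which each step changes by
  -1, 0 or 1. Taking it in the integers treats both directions of travel alike.\<close>

lemma relpow_cycle_graph_shift:
  assumes "(i, j) \<in> ((parcs (cycle_graph t))\<^sup>=) ^^ n" "i < t"
  shows "\<exists>k\<in>{-int n..int n}. int j = (int i + k) mod int t"
  using assms(1)
proof (induction n arbitrary: j)
  case 0
  with assms(2) show ?case by simp
next
  case (Suc n)
  then obtain l where l: "(i, l) \<in> ((parcs (cycle_graph t))\<^sup>=) ^^ n"
      "(l, j) \<in> (parcs (cycle_graph t))\<^sup>="
    by (auto elim: relpow_Suc_E)
  from Suc.IH[OF l(1)] obtain k where k: "k \<in> {-int n..int n}" "int l = (int i + k) mod int t"
    by blast
  from l(2) consider "j = l" | "j = (l + 1) mod t" | "j < t" "l = (j + 1) mod t"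
    by (auto simp: cycle_graph_def)
  then show ?case
  proof cases
    case 1
    with k show ?thesis by (intro bexI[of _ k]) auto
  next
    case 2
    then have "int j = (int i + (k + 1)) mod int t"
      using k(2) by (simp add: zmod_int mod_simps algebra_simps)
    with k(1) show ?thesis by (intro bexI[of _ "k + 1"]) auto
  next
    case 3
    \<comment> \<open>A backward step is encoded as a forward step from \<open>j\<close> to
      \<open>l\<close>. Subtracting 1 recovers \<open>j\<close> modulo \<open>t\<close>, and
      \<open>j < t\<close> then removes the modulus.\<close>
    have "(int i + (k - 1)) mod int t = (int l - 1) mod int t"
      unfolding k(2) by (simp add: mod_simps algebra_simps)
    also have "\<dots> = int j mod int t"
      unfolding 3(2) by (simp add: zmod_int mod_simps)
    also have "\<dots> = int j" using 3(1) by simp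
    finally show ?thesis using k(1) by (intro bexI[of _ "k - 1"]) auto
  qed
qed

text \<open>The ball of radius \<open>n\<close> is covered by the \<open>2 * n + 1\<close>
  displacements. Only an upper bound results, since displacements may coincide once the ball wraps
  around the cycle.\<close>

lemma card_ball_cycle_graph:
  assumes "j < t" "t \<ge> 3"
  shows "card {i\<in>{..<t}. graph_dist (cycle_graph t) j i < Suc n} \<le> 2 * n + 1"
proof -
  interpret pair_graph "cycle_graph t" using assms(2) by (rule pair_graph_cycle_graph)
  let ?f = "\<lambda>k. nat ((int j + k) mod int t)"
  have "i \<in> ?f ` {-int n..int n}" if "i < t" "graph_dist (cycle_graph t) j i < Suc n" for i
  proof -
    have "j \<in> pverts (cycle_graph t)" using assms by (simp add: cycle_graph_def)
    then have "(j, i) \<in> ((parcs (cycle_graph t))\<^sup>=) ^^ n"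
      using that graph_dist_le_iff[OF _ rtrancl_cycle_graph[OF assms(1) that(1) assms(2)]]
      by (simp add: less_Suc_eq_le)
    from relpow_cycle_graph_shift[OF this assms(1)] show ?thesis
      by (metis image_eqI nat_int)
  qed
  then have "{i\<in>{..<t}. graph_dist (cycle_graph t) j i < Suc n} \<subseteq> ?f ` {-int n..int n}"
    by blast
  then have "card {i\<in>{..<t}. graph_dist (cycle_graph t) j i < Suc n} \<le> card {-int n..int n}"
    by (intro surj_card_le) auto
  then show ?thesis by simp
qed

section \<open>Counting generator elements near each layer\<close>

lemma sum_card_double_count:
  assumes "finite A" "finite B"
  shows "(\<Sum>i\<in>A. card {s\<in>B. R i s}) = (\<Sum>s\<in>B. card {i\<in>A. R i s})"
  using assms by (intro sum_multicount_gen) auto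

lemma cycle_length_le_card_generator:
  assumes graph: "pair_graph G"
    and conn: "\<And>u v. u \<in> pverts G \<Longrightarrow> v \<in> pverts G \<Longrightarrow> (u, v) \<in> (parcs G)\<^sup>*"
    and card: "card (pverts G) \<ge> 2" and t: "t \<ge> 3"
    and gen: "local_metric_generator (strong_product (cycle_graph t) G) S"
  shows "t \<le> card S * diameter G"
proof -
  interpret G: pair_graph G by fact
  interpret C: pair_graph "cycle_graph t" using t by (rule pair_graph_cycle_graph)
  let ?D = "diameter G"
  let ?d = "\<lambda>s i. graph_dist (cycle_graph t) (fst s) i"
  have S: "fst s < t" "snd s \<in> pverts G" if "s \<in> S" for s
    using that gen
    by (auto simp: local_metric_generator_def strong_product_def cycle_graph_def)
  have "S \<subseteq> {..<t} \<times> pverts G" using S by force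
  then have finS: "finite S" by (rule finite_subset) (simp add: G.pair_finite_verts)
  \<comment> \<open>The neighbour is the second vertex of a walk from \<open>u\<close> to some other
    vertex.\<close>
  have nbr: "\<exists>v. (u, v) \<in> parcs G" if u: "u \<in> pverts G" for u
  proof -
    from card u obtain v where "v \<in> pverts G" "v \<noteq> u"
      by (metis card_le_Suc0_iff_eq G.pair_finite_verts not_less_eq_eq numeral_2_eq_2)
    with conn[OF u] show ?thesis by (metis converse_rtranclE)
  qed
  have dist: "graph_dist (strong_product (cycle_graph t) G) s (i, u)
      = max (?d s i) (graph_dist G (snd s) u)" if "s \<in> S" "i < t" "u \<in> pverts G" for s i u
    using graph_dist_strong_product[OF C.pair_graph graph, of "fst s" "snd s" i u]
      S[OF that(1)] that conn rtrancl_cycle_graph[OF _ _ t]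
    by (simp add: cycle_graph_def)
  have resolve: "\<exists>s\<in>S. max (?d s i) (graph_dist G (snd s) u)
      \<noteq> max (?d s i) (graph_dist G (snd s) v)"
    if i: "i < t" and uv: "(u, v) \<in> parcs G" for i u v
  proof -
    have verts: "u \<in> pverts G" "v \<in> pverts G" using uv by (auto dest: G.in_arcsD1 G.in_arcsD2)
    then have "((i, u), (i, v)) \<in> parcs (strong_product (cycle_graph t) G)"
      using i uv by (simp add: strong_product_def cycle_graph_def)
    with gen obtain s where "s \<in> S" "graph_dist (strong_product (cycle_graph t) G) s (i, u)
        \<noteq> graph_dist (strong_product (cycle_graph t) G) s (i, v)"
      by (auto simp: local_metric_generator_def)
    then show ?thesis using dist i verts by auto
  qed
  have near: "?d s i < ?D" if "s \<in> S" "(u, v) \<in> parcs G"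
    "max (?d s i) (graph_dist G (snd s) u) \<noteq> max (?d s i) (graph_dist G (snd s) v)" for s i u v
  proof -
    have "graph_dist G (snd s) u \<le> ?D" "graph_dist G (snd s) v \<le> ?D"
      using S(2)[OF that(1)] G.in_arcsD1[OF that(2)] G.in_arcsD2[OF that(2)]
      by (simp_all add: G.graph_dist_le_diameter)
    with that(3) show ?thesis by linarith
  qed
  \<comment> \<open>The weights 1 and 1/2 are doubled to stay in the naturals: an element in layer
    \<open>i\<close> is counted by both sets, a nearby element of another layer only by the
    second.\<close>
  have layer: "2 \<le> card {s\<in>S. ?d s i < Suc 0} + card {s\<in>S. ?d s i < ?D}" if i: "i < t" for i
  proof -
    obtain u where "u \<in> pverts G" using card by fastforce
    with nbr obtain v where uv: "(u, v) \<in> parcs G" by blast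
    from resolve[OF i uv] near[OF _ uv] obtain s where s: "s \<in> S" "?d s i < ?D" by blast
    show ?thesis
    proof (cases "?d s i = 0")
      case True
      with s have "{s} \<subseteq> {s\<in>S. ?d s i < Suc 0}" "{s} \<subseteq> {s\<in>S. ?d s i < ?D}" by auto
      then have "card {s} \<le> card {s\<in>S. ?d s i < Suc 0}" "card {s} \<le> card {s\<in>S. ?d s i < ?D}"
        using finS by (intro card_mono; simp)+
      then show ?thesis by simp
    next
      case False
      have w: "snd s \<in> pverts G" using S s by blast
      \<comment> \<open>This edge is chosen so that \<open>s\<close> cannot resolve it: its ends are
        at distance 0 and at most 1 from \<open>snd s\<close>, so both maxima equal
        \<open>?d s i\<close>, which is at least 1 here. The resolving element is therefore a new
        one.\<close>
      with nbr obtain v where v: "(snd s, v) \<in> parcs G" by blast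
      from resolve[OF i v] obtain s' where s': "s' \<in> S"
        "max (?d s' i) (graph_dist G (snd s') (snd s)) \<noteq> max (?d s' i) (graph_dist G (snd s') v)"
        by blast
      have "graph_dist G (snd s) v \<le> 1"
        using G.graph_dist_le_iff[of "snd s" v 1] v w by auto
      then have "s' \<noteq> s"
        using s'(2) False G.graph_dist_refl[OF w] by auto
      then have "card {s, s'} = 2" by simp
      moreover have "{s, s'} \<subseteq> {s\<in>S. ?d s i < ?D}" using near[OF s'(1) v s'(2)] s s' by auto
      then have "card {s, s'} \<le> card {s\<in>S. ?d s i < ?D}" using finS by (intro card_mono) auto
      ultimately show ?thesis by linarith
    qed
  qed
  \<comment> \<open>Any resolving element lies at cycle distance less than \<open>?D\<close>, so the
    mere existence of one gives positivity. This allows the radius \<open>n\<close> =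
    \<open>?D\<close> - 1 below.\<close>
  have "0 < ?D"
  proof -
    obtain u where u: "u \<in> pverts G" using card by fastforce
    with nbr obtain v where uv: "(u, v) \<in> parcs G" by blast
    from resolve[of 0, OF _ uv] near[OF _ uv] t show ?thesis by fastforce
  qed
  then obtain n where n: "?D = Suc n" by (cases ?D) auto
  have "t * 2 = (\<Sum>i<t. 2)" by simp
  also have "\<dots> \<le> (\<Sum>i<t. card {s\<in>S. ?d s i < Suc 0} + card {s\<in>S. ?d s i < ?D})"
    using layer by (intro sum_mono) auto
  also have "\<dots> = (\<Sum>s\<in>S. card {i\<in>{..<t}. ?d s i < Suc 0} + card {i\<in>{..<t}. ?d s i < ?D})"
    using finS by (simp add: sum.distrib sum_card_double_count)
  also have "\<dots> \<le> (\<Sum>s\<in>S. 2 * ?D)"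
  proof (rule sum_mono)
    fix s assume "s \<in> S"
    then show "card {i\<in>{..<t}. ?d s i < Suc 0} + card {i\<in>{..<t}. ?d s i < ?D} \<le> 2 * ?D"
      \<comment> \<open>The balls of radius 0 and \<open>n\<close> contribute at most 1 +
        (2\<open>n\<close> + 1) = 2 \<open>?D\<close>.\<close>
      using card_ball_cycle_graph[of "fst s" t 0] card_ball_cycle_graph[of "fst s" t n] S t n
      by fastforce
  qed
  finally show ?thesis by simp
qed

theorem theorem21:
  fixes G :: "'a pair_pre_digraph" and t :: nat
  assumes "pair_graph G"
    and "Digraph_Component.connected (with_proj G)"
    and "card (pverts G) \<ge> 2"
    and "t \<ge> 3"
  shows "int (local_metric_dim (strong_product (cycle_graph t) G))
           \<ge> \<lceil>real t / real (diameter G)\<rceil>"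
proof -
  let ?P = "strong_product (cycle_graph t) G"
  interpret G: pair_graph G by fact
  interpret P: pair_graph ?P
    using assms by (intro pair_graph_strong_product pair_graph_cycle_graph)
  note conn = G.connected_imp_rtrancl_parcs[OF assms(2)]
  have "(x, y) \<in> (parcs ?P)\<^sup>*" if "x \<in> pverts ?P" "y \<in> pverts ?P" for x y
    using that rtrancl_strong_product[OF pair_graph_cycle_graph[OF assms(4)] assms(1)]
      rtrancl_cycle_graph[OF _ _ assms(4)] conn
    by (auto simp: strong_product_def cycle_graph_def)
  moreover have "(x, x) \<notin> parcs ?P" for x
    using P.pair_no_loops[of "(x, x)"] by auto
  ultimately obtain S where S: "local_metric_generator ?P S" "card S = local_metric_dim ?P"
    using P.local_metric_generator_card_dim by metis
  have "t \<le> local_metric_dim ?P * diameter G"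
    using cycle_length_le_card_generator[OF assms(1) conn assms(3,4) S(1)] S(2) by simp
  then have "real t \<le> real (local_metric_dim ?P) * real (diameter G)"
    by (metis of_nat_le_iff of_nat_mult)
  then have "real t / real (diameter G) \<le> real (local_metric_dim ?P)"
    \<comment> \<open>Real division by zero yields 0, which settles the degenerate case; otherwise
      the positive denominator is cleared.\<close>
    by (cases "diameter G = 0") (auto simp: divide_simps)
  then show ?thesis by (simp add: ceiling_le_iff)
qed

end
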